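(* Let $0\le m\le n$ and let $t$ be a descending alternating basis or an ascending alternating basis of $\mathrm{span}\{x^m,x^{m+1},\ldots,x^n\}$, and let $v$ be a basis of the same space such that the change of basis matrix $M_{vt}$ has the descending alternating form (if $t$ is descending) or the ascending alternating form (if $t$ is ascending) with coefficient function $\beta$. Then the inverse change of basis matrix $M_{tv}=M_{vt}^{-1}$ has the same form as $M_{vt}$ except that $\beta$ is replaced by its inverse coefficient function $\beta^{-1}$ (the coefficient function of the mapping from $v$ to $t$).
   Context: Rows and columns are indexed by $0\le i,j\le n-m$. For ordered bases $v,t$ of the same space, $M_{vt}$ is the matrix whose $j$-th column is the coordinate vector with respect to $v$ of the $j$-th element of $t$. A descending alternating basis is a basis $(p_0,\ldots,p_{n-m})$ of $\mathrm{span}\{x^m,\ldots,x^n\}$ where $p_j$ has degree $m+j$ and contains only monomials $x^e$ with $e\equiv m+j\pmod 2$. An ascending alternating basis is a basis $(p_0,\ldots,p_{n-m})$ of this space where $p_j$ has minimum degree (least exponent with nonzero coefficient) $m+j$ and contains only monomials $x^e$ with $e\equiv m+j\pmod 2$. Descending alternating form with coefficient function $\beta$: the $(i,j)$ entry is $\beta\bigl(m+j,\;m+(j\bmod 2),\;\tfrac{j-i}{2}\bigr)$ if $j\ge i$ and $j-i$ is even, and $0$ otherwise. Ascending alternating form with coefficient function $\beta$: the $(i,j)$ entry is $\beta\bigl(n_j,\;m+j,\;\lfloor\tfrac{n-m-i}{2}\rfloor\bigr)$ if $i\ge j$ and $i-j$ is even, and $0$ otherwise, where $n_j\in\{n-1,n\}$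 is the integer with $n_j\equiv m+j\pmod 2$. Inverse coefficient function. For $c\in\{m,m+1\}$ with $c\le n$, let $N_c$ be the largest integer $\le n$ with $N_c\equiv c\pmod 2$ and let $L_c=(N_c-c)/2$. In the descending case, let $B_c$ be the upper triangular definite-parity change of basis matrix with entries $(B_c)_{i,j}=\beta(c+2j,c,j-i)$ for $0\le i\le j\le L_c$ and $0$ for $j<i$; then $\beta^{-1}$ is defined by $(B_c^{-1})_{i,j}=\beta^{-1}(c+2j,c,j-i)$ for $i\le j$. In the ascending case, let $B_c$ be the lower triangular definite-parity change of basis matrix with entries $(B_c)_{i,j}=\beta(N_c,c+2j,L_c-i)$ for $0\le j\le i\le L_c$ and $0$ for $i<j$; then $\beta^{-1}$ is defined by $(B_c^{-1})_{i,j}=\beta^{-1}(N_c,c+2j,L_c-i)$ for $j\le i$. Here $\beta^{-1}$ denotes this function, not a reciprocal. *)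

theory Defs
  imports "HOL-Computational_Algebra.Polynomial" "Jordan_Normal_Form.Matrix"
begin

global_interpretation poly_vs: vector_space "Polynomial.smult :: 'a::field \<Rightarrow> 'a poly \<Rightarrow> 'a poly"
  by unfold_locales (simp_all add: Polynomial.smult_add_right Polynomial.smult_add_left)

definition monom_space :: "nat \<Rightarrow> nat \<Rightarrow> 'a::field poly set" where
  "monom_space m n = poly_vs.span ((\<lambda>e. monom 1 e) ` {m..n})"

definition ordered_basis :: "'a::field poly set \<Rightarrow> 'a poly list \<Rightarrow> bool" where
  "ordered_basis V b \<longleftrightarrow>
     distinct b \<and> poly_vs.independent (set b) \<and> poly_vs.span (set b) = V"

definition change_of_basis_mat :: "'a::field poly list \<Rightarrow> 'a poly list \<Rightarrow> 'a mat" where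
  "change_of_basis_mat v t =
     mat (length v) (length t) (\<lambda>(i, j). poly_vs.representation (set v) (t ! j) (v ! i))"

definition descending_alternating_basis :: "nat \<Rightarrow> nat \<Rightarrow> 'a::field poly list \<Rightarrow> bool" where
  "descending_alternating_basis m n p \<longleftrightarrow>
     ordered_basis (monom_space m n) p \<and> length p = n - m + 1 \<and>
     (\<forall>j \<le> n - m. degree (p ! j) = m + j \<and>
        (\<forall>e. coeff (p ! j) e \<noteq> 0 \<longrightarrow> e mod 2 = (m + j) mod 2))"

(* The elements of a basis are nonzero, so the LEAST exponent below is attained. *)
definition ascending_alternating_basis :: "nat \<Rightarrow> nat \<Rightarrow> 'a::field poly list \<Rightarrow> bool" where
  "ascending_alternating_basis m n p \<longleftrightarrow>
     ordered_basis (monom_space m n) p \<and> length p = n - m + 1 \<and>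
     (\<forall>j \<le> n - m. (LEAST e. coeff (p ! j) e \<noteq> 0) = m + j \<and>
        (\<forall>e. coeff (p ! j) e \<noteq> 0 \<longrightarrow> e mod 2 = (m + j) mod 2))"

(* For e \<le> n this is the unique element of {n - 1, n} congruent to e modulo 2,
   so it serves both as N_c (with e = c) and as n_j (with e = m + j). *)
definition top_exponent :: "nat \<Rightarrow> nat \<Rightarrow> nat" where
  "top_exponent n e = (GREATEST N. N \<le> n \<and> N mod 2 = e mod 2)"

lemma top_exponent_eq:
  assumes "e \<le> n"
  shows "top_exponent n e = (if n mod 2 = e mod 2 then n else n - 1)"
  unfolding top_exponent_def
proof (rule Greatest_equality)
  show "(if n mod 2 = e mod 2 then n else n - 1) \<le> n \<and>
        (if n mod 2 = e mod 2 then n else n - 1) mod 2 = e mod 2"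
    using assms by (cases n) (auto, presburger+)
next
  fix y assume "y \<le> n \<and> y mod 2 = e mod 2"
  then show "y \<le> (if n mod 2 = e mod 2 then n else n - 1)"
    by (cases "y = n") auto
qed

definition descending_alternating_form ::
  "nat \<Rightarrow> nat \<Rightarrow> (nat \<Rightarrow> nat \<Rightarrow> nat \<Rightarrow> 'a::field) \<Rightarrow> 'a mat \<Rightarrow> bool" where
  "descending_alternating_form m n \<beta> A \<longleftrightarrow>
     A \<in> carrier_mat (n - m + 1) (n - m + 1) \<and>
     (\<forall>i \<le> n - m. \<forall>j \<le> n - m.
        A $$ (i, j) = (if i \<le> j \<and> even (j - i)
                       then \<beta> (m + j) (m + j mod 2) ((j - i) div 2) else 0))"

definition ascending_alternating_form ::
  "nat \<Rightarrow> nat \<Rightarrow> (nat \<Rightarrow> nat \<Rightarrow> nat \<Rightarrow> 'a::field) \<Rightarrow> 'a mat \<Rightarrow> bool" where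
  "ascending_alternating_form m n \<beta> A \<longleftrightarrow>
     A \<in> carrier_mat (n - m + 1) (n - m + 1) \<and>
     (\<forall>i \<le> n - m. \<forall>j \<le> n - m.
        A $$ (i, j) = (if j \<le> i \<and> even (i - j)
                       then \<beta> (top_exponent n (m + j)) (m + j) ((n - m - i) div 2) else 0))"

definition parity_length :: "nat \<Rightarrow> nat \<Rightarrow> nat" where
  "parity_length n c = (top_exponent n c - c) div 2"

definition descending_parity_mat ::
  "nat \<Rightarrow> (nat \<Rightarrow> nat \<Rightarrow> nat \<Rightarrow> 'a::field) \<Rightarrow> nat \<Rightarrow> 'a mat" where
  "descending_parity_mat n \<beta> c =
     mat (parity_length n c + 1) (parity_length n c + 1)
       (\<lambda>(i, j). if i \<le> j then \<beta> (c + 2 * j) c (j - i) else 0)"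

definition ascending_parity_mat ::
  "nat \<Rightarrow> (nat \<Rightarrow> nat \<Rightarrow> nat \<Rightarrow> 'a::field) \<Rightarrow> nat \<Rightarrow> 'a mat" where
  "ascending_parity_mat n \<beta> c =
     mat (parity_length n c + 1) (parity_length n c + 1)
       (\<lambda>(i, j). if j \<le> i then \<beta> (top_exponent n c) (c + 2 * j) (parity_length n c - i) else 0)"

(* For square A, the two equations also force B to have the dimensions of A. *)
definition is_inverse_mat :: "'a::field mat \<Rightarrow> 'a mat \<Rightarrow> bool" where
  "is_inverse_mat A B \<longleftrightarrow> inverts_mat A B \<and> inverts_mat B A"

(* The inverse matrices determine an inverse coefficient function only at the arguments
   that occur below, hence a relation between \<beta> and \<beta>' rather than a function of \<beta>.
   The relation includes the invertibility of the definite-parity matrices. *)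
definition descending_inverse_coeff ::
  "nat \<Rightarrow> nat \<Rightarrow> (nat \<Rightarrow> nat \<Rightarrow> nat \<Rightarrow> 'a::field) \<Rightarrow> (nat \<Rightarrow> nat \<Rightarrow> nat \<Rightarrow> 'a) \<Rightarrow> bool" where
  "descending_inverse_coeff m n \<beta> \<beta>' \<longleftrightarrow>
     (\<forall>c \<in> {m, m + 1}. c \<le> n \<longrightarrow>
        (\<exists>B'. is_inverse_mat (descending_parity_mat n \<beta> c) B' \<and>
           (\<forall>i j. i \<le> j \<and> j \<le> parity_length n c \<longrightarrow>
              B' $$ (i, j) = \<beta>' (c + 2 * j) c (j - i))))"

definition ascending_inverse_coeff ::
  "nat \<Rightarrow> nat \<Rightarrow> (nat \<Rightarrow> nat \<Rightarrow> nat \<Rightarrow> 'a::field) \<Rightarrow> (nat \<Rightarrow> nat \<Rightarrow> nat \<Rightarrow> 'a) \<Rightarrow> bool" where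
  "ascending_inverse_coeff m n \<beta> \<beta>' \<longleftrightarrow>
     (\<forall>c \<in> {m, m + 1}. c \<le> n \<longrightarrow>
        (\<exists>B'. is_inverse_mat (ascending_parity_mat n \<beta> c) B' \<and>
           (\<forall>i j. j \<le> i \<and> i \<le> parity_length n c \<longrightarrow>
              B' $$ (i, j) = \<beta>' (top_exponent n c) (c + 2 * j) (parity_length n c - i))))"

end

theory Submission
  imports Defs "Jordan_Normal_Form.Determinant"
begin

text \<open>
  The matrices \<open>M\<^sub>v\<^sub>t\<close> and \<open>M\<^sub>t\<^sub>v\<close> are mutually inverse because both bases span the same space, so
  the question is how inversion acts on a matrix of alternating form. Two facts answer it.

  First, inversion preserves the zero pattern. A descending form vanishes at \<open>(i, j)\<close> unless
  \<open>i \<le> j\<close> and \<open>i \<equiv> j\<close> modulo 2; this is a partial order on indices contained in \<open>\<le>\<close>, and matrices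
  supported on such an order form an incidence algebra, which is closed under inverses
  (\<open>inverse_mat_supported_upper\<close>). The ascending pattern is the transpose of this one
  (\<open>inverse_mat_supported_lower\<close>).

  Secondly, the pattern splits the index set into the two parity classes, so that the matrix is,
  up to a simultaneous permutation of rows and columns, block diagonal. Its inverse is then
  obtained by inverting each block (\<open>is_inverse_parity_block\<close>). The blocks of \<open>M\<^sub>v\<^sub>t\<close> are
  exactly the definite-parity matrices with \<open>c = m\<close> and \<open>c = m + 1\<close> (if \<open>m < n\<close>), whose inverses define the
  inverse coefficient function. Uniqueness of inverses identifies these with the blocks of
  \<open>M\<^sub>t\<^sub>v\<close>, which gives its nonzero entries. The same identification gives the existence of an
  inverse coefficient function: the three arguments at which it is prescribed determine the
  position in \<open>M\<^sub>t\<^sub>v\<close> from which its value can be read.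
\<close>

section \<open>Change of basis matrices\<close>

lemma sum_representation_ordered_basis:
  assumes "ordered_basis V b" "x \<in> V"
  shows "(\<Sum>k<length b. Polynomial.smult (poly_vs.representation (set b) x (b ! k)) (b ! k)) = x"
proof -
  have b: "distinct b" "poly_vs.independent (set b)" "poly_vs.span (set b) = V"
    using assms(1) by (auto simp: ordered_basis_def)
  have "(\<Sum>k<length b. Polynomial.smult (poly_vs.representation (set b) x (b ! k)) (b ! k))
      = (\<Sum>y\<in>set b. Polynomial.smult (poly_vs.representation (set b) x y) y)"
    by (rule sum.reindex_bij_betw) (simp add: bij_betw_nth b(1))
  also have "\<dots> = x"
    using poly_vs.sum_representation_eq[of "set b" x "set b"] b assms(2) by simp
  finally show ?thesis .
qed

text \<open>
  Expand \<open>v ! j\<close> in the basis \<open>t\<close> and take coordinates with respect to \<open>v\<close> on both sides; these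
  are linear, and the coordinates of \<open>v ! j\<close> itself form a unit vector.
\<close>

lemma change_of_basis_mat_mult:
  assumes v: "ordered_basis V v" and t: "ordered_basis V t"
  shows "change_of_basis_mat v t * change_of_basis_mat t v = 1\<^sub>m (length v)"
proof (rule eq_matI)
  fix i j assume "i < dim_row (1\<^sub>m (length v) :: 'a mat)" "j < dim_col (1\<^sub>m (length v) :: 'a mat)"
  then have ij: "i < length v" "j < length v" by auto
  have sv: "poly_vs.independent (set v)" "poly_vs.span (set v) = V" "distinct v"
    and st: "poly_vs.span (set t) = V"
    using v t by (auto simp: ordered_basis_def)
  have vj: "v ! j \<in> V" using poly_vs.span_base[of "v ! j" "set v"] sv(2) ij by simp
  have tk: "t ! k \<in> poly_vs.span (set v)" if "k < length t" for k
    using poly_vs.span_base[of "t ! k" "set t"] st sv(2) that by simp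
  let ?r = "\<lambda>k. poly_vs.representation (set t) (v ! j) (t ! k)"
  have "(change_of_basis_mat v t * change_of_basis_mat t v) $$ (i, j)
      = (\<Sum>k<length t. poly_vs.representation (set v) (t ! k) (v ! i) * ?r k)"
    using ij by (simp add: change_of_basis_mat_def scalar_prod_def atLeast0LessThan)
  also have "\<dots> = (\<Sum>k<length t. poly_vs.representation (set v) (Polynomial.smult (?r k) (t ! k)) (v ! i))"
    using sv(1) tk by (intro sum.cong) (simp_all add: poly_vs.representation_scale)
  also have "\<dots> = poly_vs.representation (set v) (\<Sum>k<length t. Polynomial.smult (?r k) (t ! k)) (v ! i)"
    using sv(1) tk by (subst poly_vs.representation_sum) (auto intro: poly_vs.span_scale)
  also have "\<dots> = poly_vs.representation (set v) (v ! j) (v ! i)"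
    by (simp only: sum_representation_ordered_basis[OF t vj])
  also have "\<dots> = (if v ! i = v ! j then 1 else 0)"
    using poly_vs.representation_basis[OF sv(1), of "v ! j"] ij by auto
  also have "\<dots> = 1\<^sub>m (length v) $$ (i, j)"
    using ij sv(3) by (simp add: nth_eq_iff_index_eq)
  finally show "(change_of_basis_mat v t * change_of_basis_mat t v) $$ (i, j) = 1\<^sub>m (length v) $$ (i, j)" .
qed (auto simp: change_of_basis_mat_def)

lemma is_inverse_change_of_basis_mat:
  assumes "ordered_basis V v" "ordered_basis V t"
  shows "is_inverse_mat (change_of_basis_mat v t) (change_of_basis_mat t v)"
  using change_of_basis_mat_mult[OF assms] change_of_basis_mat_mult[OF assms(2,1)]
  by (simp add: is_inverse_mat_def inverts_mat_def change_of_basis_mat_def)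

section \<open>Inverses of sparse matrices\<close>

lemma is_inverse_matD:
  assumes "is_inverse_mat A B" "A \<in> carrier_mat N N"
  shows "B \<in> carrier_mat N N" "A * B = 1\<^sub>m N" "B * A = 1\<^sub>m N"
proof -
  have AB: "A * B = 1\<^sub>m N" and BA: "B * A = 1\<^sub>m (dim_row B)"
    using assms by (auto simp: is_inverse_mat_def inverts_mat_def)
  have "dim_col B = N" using arg_cong[OF AB, of dim_col] by simp
  moreover have "dim_row B = N" using arg_cong[OF BA, of dim_col] assms(2) by simp
  ultimately show "B \<in> carrier_mat N N" "A * B = 1\<^sub>m N" "B * A = 1\<^sub>m N"
    using AB BA by auto
qed

lemma is_inverse_mat_unique:
  assumes "is_inverse_mat A B" "is_inverse_mat A C" "A \<in> carrier_mat N N"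
  shows "B = C"
proof -
  note B = is_inverse_matD[OF assms(1,3)] and C = is_inverse_matD[OF assms(2,3)]
  have "B = B * (A * C)" using B(1) C(2) by simp
  also have "\<dots> = (B * A) * C" using B(1) C(1) assms(3) by (simp add: assoc_mult_mat)
  also have "\<dots> = C" using B(3) C(1) by simp
  finally show ?thesis .
qed

lemma is_inverse_mat_transpose:
  assumes "is_inverse_mat A B" "A \<in> carrier_mat N N"
  shows "is_inverse_mat (transpose_mat A) (transpose_mat B)"
proof -
  note B = is_inverse_matD[OF assms]
  have "transpose_mat A * transpose_mat B = 1\<^sub>m N" "transpose_mat B * transpose_mat A = 1\<^sub>m N"
    using transpose_mult[OF B(1) assms(2)] transpose_mult[OF assms(2) B(1)] B(2,3)
    by (metis transpose_one)+
  then show ?thesis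
    using B(1) assms(2) by (simp add: is_inverse_mat_def inverts_mat_def)
qed

lemma upper_triangular_diag_nonzero:
  fixes A :: "'a::field mat"
  assumes "is_inverse_mat A B" "A \<in> carrier_mat N N" "upper_triangular A" "j < N"
  shows "A $$ (j, j) \<noteq> 0"
proof
  assume "A $$ (j, j) = 0"
  then have "0 \<in> set (diag_mat A)" using assms(2,4) by (force simp: diag_mat_def)
  then have "det A = 0"
    using det_upper_triangular[OF assms(3,2)] by (simp add: prod_list_zero_iff)
  moreover have "det A * det B = 1"
    using det_mult[OF assms(2), of B] is_inverse_matD[OF assms(1,2)] by simp
  ultimately show False by simp
qed

text \<open>
  Column \<open>j\<close> of \<open>B * A = 1\<close> expresses \<open>B $$ (i, j)\<close> by earlier entries of row \<open>i\<close>: in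
  \<open>\<Sum>k. B $$ (i, k) * A $$ (k, j)\<close> only the \<open>k\<close> with \<open>R k j\<close> matter, and if \<open>\<not> R i j\<close>, then
  transitivity excludes \<open>R i k\<close> for each of them, so all terms with \<open>k < j\<close> vanish by induction.
  What remains is \<open>B $$ (i, j)\<close> times a diagonal entry of \<open>A\<close>, which is nonzero as \<open>A\<close> is
  triangular and invertible. In contrast to conjugation by \<open>diag(1, -1, 1, \<dots>)\<close>, which would
  give the parity pattern, this works in characteristic 2 as well.
\<close>

lemma inverse_mat_supported_upper:
  fixes A :: "'a::field mat"
  assumes inv: "is_inverse_mat A B" and A: "A \<in> carrier_mat N N"
    and trans: "\<And>i j k. R i j \<Longrightarrow> R j k \<Longrightarrow> R i k"
    and le: "\<And>i j. R i j \<Longrightarrow> i \<le> j"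
    and supp: "\<And>i j. i < N \<Longrightarrow> j < N \<Longrightarrow> A $$ (i, j) \<noteq> 0 \<Longrightarrow> R i j"
    and i: "i < N" and j: "j < N" and nz: "B $$ (i, j) \<noteq> 0"
  shows "R i j"
proof -
  note B = is_inverse_matD[OF inv A]
  have ut: "upper_triangular A"
    unfolding upper_triangular_def using A supp le
    by (metis carrier_matD(1) leD order.strict_trans)
  note diag = upper_triangular_diag_nonzero[OF inv A ut]
  have "j < N \<Longrightarrow> \<not> R i j \<Longrightarrow> B $$ (i, j) = 0"
  proof (induction j rule: less_induct)
    case (less j)
    \<comment> \<open>The diagonal of \<open>A\<close> is nonzero, so the support hypothesis makes \<open>R\<close> reflexive below \<open>N\<close>.\<close>
    have "R j j" using diag supp less.prems(1) by blast
    then have "i \<noteq> j" using less.prems(2) by auto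
    have zero: "B $$ (i, k) * A $$ (k, j) = 0" if k: "k < N" "k \<noteq> j" for k
    proof (cases "R k j")
      case True
      have "k < j" using le[OF True] k(2) by simp
      moreover have "\<not> R i k" using True trans less.prems(2) by blast
      ultimately show ?thesis using less.IH k(1) by simp
    next
      case False
      then show ?thesis using supp k less.prems(1) by auto
    qed
    have "0 = (B * A) $$ (i, j)" using B(3) i less.prems(1) \<open>i \<noteq> j\<close> by simp
    also have "\<dots> = (\<Sum>k<N. B $$ (i, k) * A $$ (k, j))"
      using A B(1) i less.prems(1) by (auto simp: scalar_prod_def atLeast0LessThan)
    also have "\<dots> = B $$ (i, j) * A $$ (j, j)"
    proof -
      have "(\<Sum>k\<in>{..<N} - {j}. B $$ (i, k) * A $$ (k, j)) = 0"
        using zero by (intro sum.neutral) simp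
      then show ?thesis using less.prems(1) by (subst sum.remove[of _ j]) simp_all
    qed
    finally show ?case using diag[OF less.prems(1)] by simp
  qed
  then show ?thesis using j nz by blast
qed

lemma inverse_mat_supported_lower:
  fixes A :: "'a::field mat"
  assumes inv: "is_inverse_mat A B" and A: "A \<in> carrier_mat N N"
    and trans: "\<And>i j k. R i j \<Longrightarrow> R j k \<Longrightarrow> R i k"
    and le: "\<And>i j. R i j \<Longrightarrow> j \<le> i"
    and supp: "\<And>i j. i < N \<Longrightarrow> j < N \<Longrightarrow> A $$ (i, j) \<noteq> 0 \<Longrightarrow> R i j"
    and i: "i < N" and j: "j < N" and nz: "B $$ (i, j) \<noteq> 0"
  shows "R i j"
proof -
  have nz': "transpose_mat B $$ (j, i) \<noteq> 0"
    using nz i j is_inverse_matD(1)[OF inv A] by simp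
  show ?thesis
    by (rule inverse_mat_supported_upper[where R = "\<lambda>x y. R y x",
          OF is_inverse_mat_transpose[OF inv A] _ _ _ _ j i nz'])
       (use A trans le supp in auto)
qed

definition parity_block :: "'a mat \<Rightarrow> nat \<Rightarrow> nat \<Rightarrow> 'a mat" where
  "parity_block A p K = mat K K (\<lambda>(i, j). A $$ (p + 2 * i, p + 2 * j))"

text \<open>
  The hypothesis on \<open>K\<close> says that \<open>K\<close> is the number of indices below \<open>N\<close> in the parity class \<open>p\<close>.
\<close>

lemma sum_parity_class:
  fixes g :: "nat \<Rightarrow> 'a::comm_monoid_add"
  assumes "p < 2" "\<And>k. p + 2 * k < N \<longleftrightarrow> k < K"
    and zero: "\<And>k. k < N \<Longrightarrow> k mod 2 \<noteq> p \<Longrightarrow> g k = 0"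
  shows "(\<Sum>k<N. g k) = (\<Sum>k<K. g (p + 2 * k))"
proof -
  have "(\<Sum>k<K. g (p + 2 * k)) = (\<Sum>k\<in>(\<lambda>k. p + 2 * k) ` {..<K}. g k)"
    by (simp add: sum.reindex inj_on_def)
  also have "\<dots> = (\<Sum>k<N. g k)"
  proof (rule sum.mono_neutral_left)
    show "\<forall>k\<in>{..<N} - (\<lambda>k. p + 2 * k) ` {..<K}. g k = 0"
    proof
      fix k assume k: "k \<in> {..<N} - (\<lambda>k. p + 2 * k) ` {..<K}"
      have "k mod 2 \<noteq> p"
      proof
        assume "k mod 2 = p"
        then have "k = p + 2 * (k div 2)" by presburger
        moreover from this have "k div 2 < K" using k assms(2)[of "k div 2"] by simp
        ultimately show False using k by blast
      qed
      then show "g k = 0" using zero k by simp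
    qed
  qed (use assms(2) in auto)
  finally show ?thesis ..
qed

text \<open>
  For \<open>i\<close> of parity \<open>p\<close>, the factor \<open>A $$ (i, k)\<close> kills all terms of \<open>(A * B) $$ (i, j)\<close> with \<open>k\<close>
  outside the parity class, so the entry is already computed within the blocks. The other product
  follows because one-sided inverses of square matrices over a field are two-sided.
\<close>

lemma is_inverse_parity_block:
  fixes A :: "'a::field mat"
  assumes inv: "is_inverse_mat A B" and A: "A \<in> carrier_mat N N"
    and supp: "\<And>i j. i < N \<Longrightarrow> j < N \<Longrightarrow> A $$ (i, j) \<noteq> 0 \<Longrightarrow> i mod 2 = j mod 2"
    and p: "p < 2" and K: "\<And>k. p + 2 * k < N \<longleftrightarrow> k < K"
  shows "is_inverse_mat (parity_block A p K) (parity_block B p K)"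
proof -
  note B = is_inverse_matD[OF inv A]
  have z: "A $$ (i, j) = 0" if "i < N" "j < N" "i mod 2 \<noteq> j mod 2" for i j
    using supp that by blast
  have pm: "(p + 2 * i) mod 2 = p" for i using p by simp
  have "parity_block A p K * parity_block B p K = 1\<^sub>m K"
  proof (rule eq_matI)
    fix i j assume "i < dim_row (1\<^sub>m K :: 'a mat)" "j < dim_col (1\<^sub>m K :: 'a mat)"
    then have ij: "i < K" "j < K" "p + 2 * i < N" "p + 2 * j < N" using K by auto
    have "(parity_block A p K * parity_block B p K) $$ (i, j)
        = (\<Sum>k<K. A $$ (p + 2 * i, p + 2 * k) * B $$ (p + 2 * k, p + 2 * j))"
      using ij by (simp add: parity_block_def scalar_prod_def atLeast0LessThan)
    also have "\<dots> = (\<Sum>k<N. A $$ (p + 2 * i, k) * B $$ (k, p + 2 * j))"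
      by (rule sum_parity_class[OF p K, symmetric]) (use z pm ij in simp)
    also have "\<dots> = (A * B) $$ (p + 2 * i, p + 2 * j)"
      using A B(1) ij by (simp add: scalar_prod_def atLeast0LessThan)
    also have "\<dots> = 1\<^sub>m K $$ (i, j)" using B(2) ij by simp
    finally show "(parity_block A p K * parity_block B p K) $$ (i, j) = 1\<^sub>m K $$ (i, j)" .
  qed (auto simp: parity_block_def)
  moreover have "parity_block B p K * parity_block A p K = 1\<^sub>m K"
    by (rule mat_mult_left_right_inverse[OF _ _ calculation]) (auto simp: parity_block_def)
  ultimately show ?thesis
    by (simp add: is_inverse_mat_def inverts_mat_def parity_block_def)
qed

section \<open>Alternating forms\<close>

lemma parity_length_eq:
  assumes "c \<le> n"
  shows "parity_length n c = (n - c) div 2"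
proof -
  obtain k where k: "n = c + k" using assms le_Suc_ex by blast
  have "n mod 2 = c mod 2 \<longleftrightarrow> even k" using k by (simp add: mod2_eq_if)
  then show ?thesis
    using k top_exponent_eq[OF assms] by (auto simp: parity_length_def elim!: oddE)
qed

lemma top_exponent_parity_length:
  assumes "c \<le> n"
  shows "top_exponent n c = c + 2 * parity_length n c"
proof -
  obtain k where k: "n = c + k" using assms le_Suc_ex by blast
  have "n mod 2 = c mod 2 \<longleftrightarrow> even k" using k by (simp add: mod2_eq_if)
  then show ?thesis
    using k parity_length_eq[OF assms] top_exponent_eq[OF assms] by (auto elim!: oddE)
qed

lemma top_exponent_add_even:
  "top_exponent n (c + 2 * k) = top_exponent n c"
  by (simp add: top_exponent_def)

lemma le_parity_length_iff:
  assumes "m + p \<le> n"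
  shows "p + 2 * k < n - m + 1 \<longleftrightarrow> k < parity_length n (m + p) + 1"
  using assms by (auto simp: parity_length_eq less_Suc_eq_le less_eq_div_iff_mult_less_eq)

text \<open>
  The ascending form measures a row by its distance from the last row, the definite-parity matrix
  by its distance from the last row of its block. Halving turns the first into the second even if
  the last row of the matrix belongs to the other parity class.
\<close>

lemma half_distance_to_top:
  assumes "m + p \<le> n"
  shows "(n - m - (p + 2 * i)) div 2 = parity_length n (m + p) - i"
proof -
  have "(x - 2 * i) div 2 = x div 2 - i" for x :: nat by presburger
  from this[of "n - (m + p)"] show ?thesis
    using assms by (simp add: parity_length_eq add.assoc)
qed

text \<open>
  Every position permitted by the parity pattern lies in exactly one of the blocks \<open>c = m + p\<close>;
  \<open>a\<close> and \<open>b\<close> are its coordinates there.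
\<close>

lemma parity_decomposition:
  fixes m :: nat
  assumes "m \<le> n" "i \<le> n - m" "j \<le> n - m" "i mod 2 = j mod 2"
  obtains p a b where "p < 2" "m + p \<le> n" "i = p + 2 * a" "j = p + 2 * b"
    "a \<le> parity_length n (m + p)" "b \<le> parity_length n (m + p)"
proof -
  have d: "i = j mod 2 + 2 * (i div 2)" "j = j mod 2 + 2 * (j div 2)"
    using assms(4) by presburger+
  have mi: "m + i \<le> n" "m + j \<le> n" using assms(1-3) by linarith+
  have le: "m + j mod 2 \<le> n" using mi(2) d(2) by linarith
  have len: "i div 2 \<le> parity_length n (m + j mod 2)" "j div 2 \<le> parity_length n (m + j mod 2)"
    unfolding parity_length_eq[OF le] less_eq_div_iff_mult_less_eq[OF zero_less_numeral]
    using mi d by linarith+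
  show thesis by (rule that[OF _ le d len]) simp
qed

lemma descending_parity_mat_eq_parity_block:
  assumes "descending_alternating_form m n \<beta> A" "p < 2" "m + p \<le> n"
  shows "descending_parity_mat n \<beta> (m + p) = parity_block A p (parity_length n (m + p) + 1)"
proof (rule eq_matI)
  fix i j assume "i < dim_row (parity_block A p (parity_length n (m + p) + 1))"
    "j < dim_col (parity_block A p (parity_length n (m + p) + 1))"
  then have ij: "i < parity_length n (m + p) + 1" "j < parity_length n (m + p) + 1"
    by (auto simp: parity_block_def)
  then have "p + 2 * i \<le> n - m" "p + 2 * j \<le> n - m"
    using le_parity_length_iff[OF assms(3)] by (metis Suc_eq_plus1 less_Suc_eq_le)+
  moreover have "(p + 2 * j) mod 2 = p" "(p + 2 * j - (p + 2 * i)) div 2 = j - i"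
    "even (p + 2 * j - (p + 2 * i))" using assms(2) by auto
  ultimately show "descending_parity_mat n \<beta> (m + p) $$ (i, j)
      = parity_block A p (parity_length n (m + p) + 1) $$ (i, j)"
    using assms(1) ij
    by (simp add: descending_parity_mat_def parity_block_def descending_alternating_form_def add.assoc)
qed (auto simp: descending_parity_mat_def parity_block_def)

lemma ascending_parity_mat_eq_parity_block:
  assumes "ascending_alternating_form m n \<beta> A" "p < 2" "m + p \<le> n"
  shows "ascending_parity_mat n \<beta> (m + p) = parity_block A p (parity_length n (m + p) + 1)"
proof (rule eq_matI)
  fix i j assume "i < dim_row (parity_block A p (parity_length n (m + p) + 1))"
    "j < dim_col (parity_block A p (parity_length n (m + p) + 1))"
  then have ij: "i < parity_length n (m + p) + 1" "j < parity_length n (m + p) + 1"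
    by (auto simp: parity_block_def)
  then have "p + 2 * i \<le> n - m" "p + 2 * j \<le> n - m"
    using le_parity_length_iff[OF assms(3)] by (metis Suc_eq_plus1 less_Suc_eq_le)+
  moreover have "(n - m - (p + 2 * i)) div 2 = parity_length n (m + p) - i"
    "even (p + 2 * i - (p + 2 * j))"
    using half_distance_to_top[OF assms(3)] by auto
  moreover have "top_exponent n (m + (p + 2 * j)) = top_exponent n (m + p)"
    using top_exponent_add_even[of n "m + p" j] by (simp add: add.assoc)
  ultimately show "ascending_parity_mat n \<beta> (m + p) $$ (i, j)
      = parity_block A p (parity_length n (m + p) + 1) $$ (i, j)"
    using assms(1) ij
    by (simp add: ascending_parity_mat_def parity_block_def ascending_alternating_form_def add.assoc)
qed (auto simp: ascending_parity_mat_def parity_block_def)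

text \<open>
  An inverse coefficient function is fixed only on the arguments that occur in the
  definite-parity inverses, so there are many of them. One is read off from \<open>B\<close>; any other agrees
  with it on the positions in the pattern, because the blocks of \<open>B\<close> are the only inverses of the
  definite-parity matrices.
\<close>

lemma descending_inverse_form:
  fixes A B :: "'a::field mat"
  assumes mn: "m \<le> n" and inv: "is_inverse_mat A B"
    and form: "descending_alternating_form m n \<beta> A"
  shows "\<exists>\<beta>'. descending_inverse_coeff m n \<beta> \<beta>'"
    and "descending_inverse_coeff m n \<beta> \<beta>' \<Longrightarrow> descending_alternating_form m n \<beta>' B"
proof -
  define N where "N = n - m + 1"
  define R where "R i j \<longleftrightarrow> i \<le> j \<and> even (j - i)" for i j :: nat
  have A: "A \<in> carrier_mat N N"
    using form by (simp add: descending_alternating_form_def N_def)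
  note B = is_inverse_matD(1)[OF inv A]
  have suppA: "R i j" if "i < N" "j < N" "A $$ (i, j) \<noteq> 0" for i j
    using form that by (auto simp: descending_alternating_form_def N_def R_def split: if_splits)
  have suppB: "R i j" if "i < N" "j < N" "B $$ (i, j) \<noteq> 0" for i j
    by (rule inverse_mat_supported_upper[OF inv A _ _ suppA])
       (use that in \<open>auto simp: R_def\<close>)
  have Rmod: "i mod 2 = j mod 2" if "R i j" for i j
    using that unfolding R_def by presburger
  have block: "is_inverse_mat (descending_parity_mat n \<beta> (m + p))
      (parity_block B p (parity_length n (m + p) + 1))" if "p < 2" "m + p \<le> n" for p
    unfolding descending_parity_mat_eq_parity_block[OF form that]
    by (rule is_inverse_parity_block[OF inv A _ that(1)])
       (use suppA Rmod le_parity_length_iff[OF that(2)] N_def in auto)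
  \<comment> \<open>At \<open>(m + j, c, (j - i) / 2)\<close> the column is \<open>j = e - m\<close> and the row is \<open>i = j - 2 * d\<close>.\<close>
  have "descending_inverse_coeff m n \<beta> (\<lambda>e c d. B $$ (e - m - 2 * d, e - m))"
    unfolding descending_inverse_coeff_def
  proof (intro ballI impI)
    fix c assume "c \<in> {m, m + 1}" "c \<le> n"
    then obtain p where p: "c = m + p" "p < 2" "m + p \<le> n"
      by (cases "c = m") (auto intro: that[of 0] that[of 1])
    show "\<exists>B'. is_inverse_mat (descending_parity_mat n \<beta> c) B' \<and>
        (\<forall>i j. i \<le> j \<and> j \<le> parity_length n c \<longrightarrow>
           B' $$ (i, j) = B $$ (c + 2 * j - m - 2 * (j - i), c + 2 * j - m))"
      using block[OF p(2,3)] unfolding p(1)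
      by (intro exI[of _ "parity_block B p (parity_length n (m + p) + 1)"])
         (auto simp: parity_block_def diff_mult_distrib2)
  qed
  then show "\<exists>\<beta>'. descending_inverse_coeff m n \<beta> \<beta>'" by blast
  assume coeff: "descending_inverse_coeff m n \<beta> \<beta>'"
  have "B $$ (i, j) = (if i \<le> j \<and> even (j - i)
      then \<beta>' (m + j) (m + j mod 2) ((j - i) div 2) else 0)"
    if ij: "i \<le> n - m" "j \<le> n - m" for i j
  proof (cases "R i j")
    case True
    obtain p a b where p: "p < 2" "m + p \<le> n"
      and ab: "i = p + 2 * a" "j = p + 2 * b"
        "a \<le> parity_length n (m + p)" "b \<le> parity_length n (m + p)"
      using parity_decomposition[OF mn ij Rmod[OF True]] by blast
    have "m + p \<in> {m, m + 1}" using p(1) by auto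
    then obtain B' where B': "is_inverse_mat (descending_parity_mat n \<beta> (m + p)) B'"
      and entry: "\<And>i j. i \<le> j \<Longrightarrow> j \<le> parity_length n (m + p) \<Longrightarrow>
        B' $$ (i, j) = \<beta>' (m + p + 2 * j) (m + p) (j - i)"
      using coeff p(2) unfolding descending_inverse_coeff_def by blast
    have "B' = parity_block B p (parity_length n (m + p) + 1)"
      by (rule is_inverse_mat_unique[OF B' block[OF p]]) (auto simp: descending_parity_mat_def)
    then have "B $$ (i, j) = \<beta>' (m + p + 2 * b) (m + p) (b - a)"
      using entry[of a b] True ab by (simp add: parity_block_def R_def)
    moreover have "j mod 2 = p" "(j - i) div 2 = b - a" using ab p(1) by auto
    ultimately show ?thesis using True ab by (simp add: R_def add.assoc)
  next
    case False
    then have "B $$ (i, j) = 0" using suppB[of i j] ij by (auto simp: N_def)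
    then show ?thesis unfolding if_not_P[OF False[unfolded R_def]] .
  qed
  then show "descending_alternating_form m n \<beta>' B"
    using B by (simp add: descending_alternating_form_def N_def)
qed

lemma ascending_inverse_form:
  fixes A B :: "'a::field mat"
  assumes mn: "m \<le> n" and inv: "is_inverse_mat A B"
    and form: "ascending_alternating_form m n \<beta> A"
  shows "\<exists>\<beta>'. ascending_inverse_coeff m n \<beta> \<beta>'"
    and "ascending_inverse_coeff m n \<beta> \<beta>' \<Longrightarrow> ascending_alternating_form m n \<beta>' B"
proof -
  define N where "N = n - m + 1"
  define R where "R i j \<longleftrightarrow> j \<le> i \<and> even (i - j)" for i j :: nat
  have A: "A \<in> carrier_mat N N"
    using form by (simp add: ascending_alternating_form_def N_def)
  note B = is_inverse_matD(1)[OF inv A]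
  have suppA: "R i j" if "i < N" "j < N" "A $$ (i, j) \<noteq> 0" for i j
    using form that by (auto simp: ascending_alternating_form_def N_def R_def split: if_splits)
  have suppB: "R i j" if "i < N" "j < N" "B $$ (i, j) \<noteq> 0" for i j
    by (rule inverse_mat_supported_lower[OF inv A _ _ suppA])
       (use that in \<open>auto simp: R_def\<close>)
  have Rmod: "i mod 2 = j mod 2" if "R i j" for i j
    using that unfolding R_def by presburger
  have block: "is_inverse_mat (ascending_parity_mat n \<beta> (m + p))
      (parity_block B p (parity_length n (m + p) + 1))" if "p < 2" "m + p \<le> n" for p
    unfolding ascending_parity_mat_eq_parity_block[OF form that]
    by (rule is_inverse_parity_block[OF inv A _ that(1)])
       (use suppA Rmod le_parity_length_iff[OF that(2)] N_def in auto)
  \<comment> \<open>The last row in the block has index \<open>M - m\<close>, and \<open>d\<close> counts block rows up from there.\<close>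
  have "ascending_inverse_coeff m n \<beta> (\<lambda>M e d. B $$ (M - m - 2 * d, e - m))"
    unfolding ascending_inverse_coeff_def
  proof (intro ballI impI)
    fix c assume "c \<in> {m, m + 1}" "c \<le> n"
    then obtain p where p: "c = m + p" "p < 2" "m + p \<le> n"
      by (cases "c = m") (auto intro: that[of 0] that[of 1])
    show "\<exists>B'. is_inverse_mat (ascending_parity_mat n \<beta> c) B' \<and>
        (\<forall>i j. j \<le> i \<and> i \<le> parity_length n c \<longrightarrow>
           B' $$ (i, j) = B $$ (top_exponent n c - m - 2 * (parity_length n c - i), c + 2 * j - m))"
      using block[OF p(2,3)] unfolding p(1) top_exponent_parity_length[OF p(3)]
      by (intro exI[of _ "parity_block B p (parity_length n (m + p) + 1)"])
         (auto simp: parity_block_def diff_mult_distrib2)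
  qed
  then show "\<exists>\<beta>'. ascending_inverse_coeff m n \<beta> \<beta>'" by blast
  assume coeff: "ascending_inverse_coeff m n \<beta> \<beta>'"
  have "B $$ (i, j) = (if j \<le> i \<and> even (i - j)
      then \<beta>' (top_exponent n (m + j)) (m + j) ((n - m - i) div 2) else 0)"
    if ij: "i \<le> n - m" "j \<le> n - m" for i j
  proof (cases "R i j")
    case True
    obtain p a b where p: "p < 2" "m + p \<le> n"
      and ab: "i = p + 2 * a" "j = p + 2 * b"
        "a \<le> parity_length n (m + p)" "b \<le> parity_length n (m + p)"
      using parity_decomposition[OF mn ij Rmod[OF True]] by blast
    have "m + p \<in> {m, m + 1}" using p(1) by auto
    then obtain B' where B': "is_inverse_mat (ascending_parity_mat n \<beta> (m + p)) B'"
      and entry: "\<And>i j. j \<le> i \<Longrightarrow> i \<le> parity_length n (m + p) \<Longrightarrow>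
        B' $$ (i, j) = \<beta>' (top_exponent n (m + p)) (m + p + 2 * j) (parity_length n (m + p) - i)"
      using coeff p(2) unfolding ascending_inverse_coeff_def by blast
    have "B' = parity_block B p (parity_length n (m + p) + 1)"
      by (rule is_inverse_mat_unique[OF B' block[OF p]]) (auto simp: ascending_parity_mat_def)
    then have "B $$ (i, j) =
        \<beta>' (top_exponent n (m + p)) (m + p + 2 * b) (parity_length n (m + p) - a)"
      using entry[of b a] True ab by (simp add: parity_block_def R_def)
    moreover have "(n - m - i) div 2 = parity_length n (m + p) - a"
      unfolding ab(1) by (rule half_distance_to_top[OF p(2)])
    moreover have "top_exponent n (m + j) = top_exponent n (m + p)"
      using top_exponent_add_even[of n "m + p" b] ab(2) by (simp add: add.assoc)
    ultimately show ?thesis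
      unfolding if_P[OF True[unfolded R_def]] using ab(2) by (simp add: add.assoc)
  next
    case False
    then have "B $$ (i, j) = 0" using suppB[of i j] ij by (auto simp: N_def)
    then show ?thesis unfolding if_not_P[OF False[unfolded R_def]] .
  qed
  then show "ascending_alternating_form m n \<beta>' B"
    using B by (simp add: ascending_alternating_form_def N_def)
qed

theorem theorem8:
  fixes m n :: nat
    and t v :: "'a::field poly list"
    and \<beta> :: "nat \<Rightarrow> nat \<Rightarrow> nat \<Rightarrow> 'a"
  assumes "m \<le> n"
    and "ordered_basis (monom_space m n) v"
  shows "(descending_alternating_basis m n t \<and>
          descending_alternating_form m n \<beta> (change_of_basis_mat v t) \<longrightarrow>
            is_inverse_mat (change_of_basis_mat v t) (change_of_basis_mat t v) \<and>
            (\<exists>\<beta>'. descending_inverse_coeff m n \<beta> \<beta>') \<and>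
            (\<forall>\<beta>'. descending_inverse_coeff m n \<beta> \<beta>' \<longrightarrow>
               descending_alternating_form m n \<beta>' (change_of_basis_mat t v))) \<and>
         (ascending_alternating_basis m n t \<and>
          ascending_alternating_form m n \<beta> (change_of_basis_mat v t) \<longrightarrow>
            is_inverse_mat (change_of_basis_mat v t) (change_of_basis_mat t v) \<and>
            (\<exists>\<beta>'. ascending_inverse_coeff m n \<beta> \<beta>') \<and>
            (\<forall>\<beta>'. ascending_inverse_coeff m n \<beta> \<beta>' \<longrightarrow>
               ascending_alternating_form m n \<beta>' (change_of_basis_mat t v)))"
proof (intro conjI impI; elim conjE)
  assume t: "descending_alternating_basis m n t"
    and form: "descending_alternating_form m n \<beta> (change_of_basis_mat v t)"
  have inv: "is_inverse_mat (change_of_basis_mat v t) (change_of_basis_mat t v)"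
    using is_inverse_change_of_basis_mat assms(2) t
    by (auto simp: descending_alternating_basis_def)
  note inverse_form = descending_inverse_form[OF assms(1) inv form]
  show "is_inverse_mat (change_of_basis_mat v t) (change_of_basis_mat t v)" by (fact inv)
  show "\<exists>\<beta>'. descending_inverse_coeff m n \<beta> \<beta>'" by (fact inverse_form(1))
  show "\<forall>\<beta>'. descending_inverse_coeff m n \<beta> \<beta>' \<longrightarrow>
      descending_alternating_form m n \<beta>' (change_of_basis_mat t v)"
    using inverse_form(2) by blast
next
  assume t: "ascending_alternating_basis m n t"
    and form: "ascending_alternating_form m n \<beta> (change_of_basis_mat v t)"
  have inv: "is_inverse_mat (change_of_basis_mat v t) (change_of_basis_mat t v)"
    using is_inverse_change_of_basis_mat assms(2) t
    by (auto simp: ascending_alternating_basis_def)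
  note inverse_form = ascending_inverse_form[OF assms(1) inv form]
  show "is_inverse_mat (change_of_basis_mat v t) (change_of_basis_mat t v)" by (fact inv)
  show "\<exists>\<beta>'. ascending_inverse_coeff m n \<beta> \<beta>'" by (fact inverse_form(1))
  show "\<forall>\<beta>'. ascending_inverse_coeff m n \<beta> \<beta>' \<longrightarrow>
      ascending_alternating_form m n \<beta>' (change_of_basis_mat t v)"
    using inverse_form(2) by blast
qed

end
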